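(* Let $H_{\aleph_0}$ be the graph defined below. For every automorphism $g$ of $H_{\aleph_0}$ and every connected component $C$ of $H_{\aleph_0}$, there exists a symplectic permutation $s$ of $\mathbb{Z}\setminus\{0\}$ such that $g(Y)=s(Y)$ for all vertices $Y\in C$. That is, the restriction of every automorphism of $H_{\aleph_0}$ to any connected component coincides with the restriction of some regular automorphism to that component.
   Context: A subset $X\subset\mathbb{Z}\setminus\{0\}$ is called singular if $i\in X$ implies $-i\notin X$; a maximal singular subset is one containing exactly one of $i,-i$ for every natural $i$. Two maximal singular subsets $X,Y$ are adjacent if $|X\setminus Y|=|Y\setminus X|=1$. The graph $H_{\aleph_0}$ has as vertices all maximal singular subsets of $\mathbb{Z}\setminus\{0\}$ and as edges the adjacent pairs. A permutation $s$ of $\mathbb{Z}\setminus\{0\}$ is symplectic if $s(-i)=-s(i)$ for all $i$; such a permutation maps maximal singular subsets to maximal singular subsets and induces an automorphism $X\mapsto s(X)$ of $H_{\aleph_0}$; automorphisms of this form are called regular. *)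

theory Defs
  imports "Graph_Theory.Graph_Theory" "HOL-Combinatorics.Permutations"
begin

definition singular :: "int set \<Rightarrow> bool" where
  "singular X \<longleftrightarrow> X \<subseteq> - {0} \<and> (\<forall>i\<in>X. - i \<notin> X)"

definition maximal_singular :: "int set \<Rightarrow> bool" where
  "maximal_singular X \<longleftrightarrow> singular X \<and> (\<forall>i::nat. i \<noteq> 0 \<longrightarrow> int i \<in> X \<or> - int i \<in> X)"

definition adjacent :: "int set \<Rightarrow> int set \<Rightarrow> bool" where
  "adjacent X Y \<longleftrightarrow> card (X - Y) = 1 \<and> card (Y - X) = 1"

text \<open>An undirected simple graph is a symmetric, loop-free digraph without parallel arcs:
  each edge is represented by its two orientations.\<close>

definition H_aleph0 :: "int set pair_pre_digraph" where
  "H_aleph0 = \<lparr> pverts = {X. maximal_singular X},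
     parcs = {(X, Y). maximal_singular X \<and> maximal_singular Y \<and> adjacent X Y} \<rparr>"

text \<open>Only the values of \<open>g\<close> on the vertices of \<open>G\<close> matter.\<close>

definition graph_automorphism :: "('a, 'b) pre_digraph \<Rightarrow> ('a \<Rightarrow> 'a) \<Rightarrow> bool" where
  "graph_automorphism G g \<longleftrightarrow>
     (\<exists>hom. pre_digraph.digraph_isomorphism G hom \<and> app_iso hom G = G \<and> iso_verts hom = g)"

text \<open>As always with \<open>permutes\<close>, the permutation of the nonzero integers is extended to \<open>int\<close>
  by fixing \<open>0\<close>.\<close>

definition symplectic :: "(int \<Rightarrow> int) \<Rightarrow> bool" where
  "symplectic s \<longleftrightarrow> s permutes (- {0}) \<and> (\<forall>i. i \<noteq> 0 \<longrightarrow> s (- i) = - s i)"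

lemma maximal_singular_iff:
  "maximal_singular X \<longleftrightarrow> 0 \<notin> X \<and> (\<forall>i. i \<noteq> 0 \<longrightarrow> (i \<in> X) \<noteq> (- i \<in> X))"
proof
  assume X: "maximal_singular X"
  have "(i \<in> X) \<noteq> (- i \<in> X)" if "i \<noteq> 0" for i
  proof -
    have "int (nat \<bar>i\<bar>) \<in> X \<or> - int (nat \<bar>i\<bar>) \<in> X"
      by (rule X[unfolded maximal_singular_def, THEN conjunct2, rule_format]) (use that in simp)
    then have "i \<in> X \<or> - i \<in> X" by (cases "i < 0") auto
    then show ?thesis using X by (auto simp: maximal_singular_def singular_def)
  qed
  then show "0 \<notin> X \<and> (\<forall>i. i \<noteq> 0 \<longrightarrow> (i \<in> X) \<noteq> (- i \<in> X))"
    using X unfolding maximal_singular_def singular_def by blast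
next
  assume X: "0 \<notin> X \<and> (\<forall>i. i \<noteq> 0 \<longrightarrow> (i \<in> X) \<noteq> (- i \<in> X))"
  have "- i \<notin> X" if "i \<in> X" for i
    using X[THEN conjunct1] X[THEN conjunct2, rule_format, of i] that by metis
  moreover have "X \<subseteq> - {0}"
    using X[THEN conjunct1] by blast
  moreover have "int i \<in> X \<or> - int i \<in> X" if "i \<noteq> 0" for i :: nat
    using X[THEN conjunct2, rule_format, of "int i"] that by simp
  ultimately show "maximal_singular X"
    unfolding maximal_singular_def singular_def by blast
qed

interpretation H_aleph0: sym_digraph H_aleph0
proof
  show "symmetric H_aleph0"
    by (auto simp: symmetric_def sym_def H_aleph0_def adjacent_def)
qed (auto simp: H_aleph0_def)

interpretation H_aleph0: loopfree_digraph H_aleph0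
  by unfold_locales (auto simp: H_aleph0_def adjacent_def)

interpretation H_aleph0: nomulti_digraph H_aleph0
  by unfold_locales (auto simp: arc_to_ends_def)

text \<open>For a symmetric digraph the strongly connected components are the connected
  components of the underlying undirected graph.\<close>

lemma H_aleph0_component_iff:
  "C \<in> pre_digraph.sccs_verts H_aleph0 \<longleftrightarrow>
     (\<exists>X. maximal_singular X \<and> C = {Y. X \<rightarrow>\<^sup>*\<^bsub>H_aleph0\<^esub> Y})"
proof -
  have "H_aleph0.scc_of X = {Y. X \<rightarrow>\<^sup>*\<^bsub>H_aleph0\<^esub> Y}" for X
    using H_aleph0.sym_arcs symmetric_reachable[of H_aleph0]
    by (auto simp: H_aleph0.scc_of_def H_aleph0.wf_digraph)
  then show ?thesis
    by (auto simp: H_aleph0.sccs_verts_conv_scc_of) (auto simp: H_aleph0_def)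
qed

lemma H_aleph0_automorphism_iff:
  "graph_automorphism H_aleph0 g \<longleftrightarrow>
     bij_betw g {X. maximal_singular X} {X. maximal_singular X} \<and>
     (\<forall>X Y. maximal_singular X \<longrightarrow> maximal_singular Y \<longrightarrow> (adjacent (g X) (g Y) \<longleftrightarrow> adjacent X Y))"
  (is "?L \<longleftrightarrow> ?R")
proof
  assume ?L
  then obtain hom where hom: "H_aleph0.digraph_isomorphism hom" "app_iso hom H_aleph0 = H_aleph0"
    and g: "iso_verts hom = g"
    by (auto simp: graph_automorphism_def)
  have verts: "g ` pverts H_aleph0 = pverts H_aleph0"
    using arg_cong[OF hom(2), of verts] g by simp
  have inj: "inj_on g (pverts H_aleph0)"
    using hom(1) g by (simp add: H_aleph0.digraph_isomorphism_def)
  have arcs: "iso_arcs hom ` parcs H_aleph0 = parcs H_aleph0"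
    using arg_cong[OF hom(2), of arcs] by simp
  have ends: "iso_tail hom = fst" "iso_head hom = snd"
    using arg_cong[OF hom(2), of tail] arg_cong[OF hom(2), of head] by simp_all
  have act: "iso_arcs hom a = (g (fst a), g (snd a))" if "a \<in> parcs H_aleph0" for a
    using hom(1) that g ends by (auto simp: H_aleph0.digraph_isomorphism_def intro!: prod_eqI)
  have "(g X, g Y) \<in> parcs H_aleph0 \<longleftrightarrow> (X, Y) \<in> parcs H_aleph0"
    if "X \<in> pverts H_aleph0" "Y \<in> pverts H_aleph0" for X Y
  proof
    assume "(g X, g Y) \<in> parcs H_aleph0"
    then obtain a where a: "a \<in> parcs H_aleph0" "(g X, g Y) = iso_arcs hom a"
      using arcs by blast
    moreover have "fst a \<in> pverts H_aleph0" "snd a \<in> pverts H_aleph0"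
      using H_aleph0.tail_in_verts[of a] H_aleph0.head_in_verts[of a] a(1) by simp_all
    ultimately have "fst a = X" "snd a = Y"
      using act inj that by (auto dest: inj_onD)
    then show "(X, Y) \<in> parcs H_aleph0" using a(1) by force
  next
    assume "(X, Y) \<in> parcs H_aleph0"
    then show "(g X, g Y) \<in> parcs H_aleph0"
      using act[of "(X, Y)"] arcs by force
  qed
  then show ?R
    using verts inj by (auto simp: H_aleph0_def bij_betw_def)
next
  assume R: ?R
  define hom where "hom = \<lparr> iso_verts = g, iso_arcs = map_prod g g, iso_head = snd, iso_tail = fst \<rparr>"
  have V: "g X \<in> {X. maximal_singular X}" if "maximal_singular X" for X
    using R that bij_betwE by fastforce
  have W: "\<exists>X. maximal_singular X \<and> g X = Y" if "maximal_singular Y" for Y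
    using R that unfolding bij_betw_def by (metis (mono_tags, lifting) imageE mem_Collect_eq)
  have inj: "inj_on g {X. maximal_singular X}"
    using R by (simp add: bij_betw_def)
  have arcs: "map_prod g g ` parcs H_aleph0 = parcs H_aleph0"
  proof (intro equalityI subsetI)
    fix e assume "e \<in> map_prod g g ` parcs H_aleph0"
    then show "e \<in> parcs H_aleph0" using R V by (auto simp: H_aleph0_def)
  next
    fix e assume e: "e \<in> parcs H_aleph0"
    then obtain X Y where XY: "e = (g X, g Y)" "maximal_singular X" "maximal_singular Y"
      using W by (auto simp: H_aleph0_def) metis
    then have "(X, Y) \<in> parcs H_aleph0" using e R by (auto simp: H_aleph0_def)
    then show "e \<in> map_prod g g ` parcs H_aleph0" using XY(1) by force
  qed
  have "H_aleph0.digraph_isomorphism hom"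
    using inj H_aleph0.wf_digraph unfolding H_aleph0.digraph_isomorphism_def
    by (auto simp: hom_def inj_on_def) (auto simp: H_aleph0_def)
  moreover have "app_iso hom H_aleph0 = H_aleph0"
    using R arcs by (simp add: app_iso_def hom_def with_proj_def bij_betw_def H_aleph0_def)
  ultimately show ?L
    unfolding graph_automorphism_def by (intro exI[of _ hom]) (simp add: hom_def)
qed

lemma symplectic_inv:
  assumes "symplectic s" shows "symplectic (inv s)"
proof -
  have s: "s permutes (- {0})" and m: "\<And>i. i \<noteq> 0 \<Longrightarrow> s (- i) = - s i"
    using assms by (auto simp: symplectic_def)
  have "inv s (- i) = - inv s i" if "i \<noteq> 0" for i
  proof -
    have "inv s i \<noteq> 0"
      using permutes_in_image[OF permutes_inv[OF s], of i] that by simp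
    then have "s (- inv s i) = - i"
      using m permutes_inverses(1)[OF s] by simp
    then show ?thesis
      using permutes_inverses(2)[OF s] by metis
  qed
  then show ?thesis
    using permutes_inv[OF s] by (auto simp: symplectic_def)
qed

lemma symplectic_maximal_singular:
  assumes "symplectic s" "maximal_singular X" shows "maximal_singular (s ` X)"
proof -
  have s: "s permutes (- {0})" using assms by (simp add: symplectic_def)
  have mem: "i \<in> s ` X \<longleftrightarrow> inv s i \<in> X" for i
    using permutes_inverses[OF s] by (metis image_iff)
  have zero: "inv s i = 0 \<longleftrightarrow> i = 0" for i
    using permutes_in_image[OF permutes_inv[OF s], of i] by auto
  have "inv s (- i) = - inv s i" if "i \<noteq> 0" for i
    using symplectic_inv[OF assms(1)] that by (simp add: symplectic_def)
  then show ?thesis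
    using assms(2) zero unfolding maximal_singular_iff mem by metis
qed

lemma symplectic_automorphism:
  assumes "symplectic s" shows "graph_automorphism H_aleph0 ((`) s)"
proof -
  have s: "s permutes (- {0})" using assms by (simp add: symplectic_def)
  have inj: "inj s" by (rule permutes_inj[OF s])
  have "adjacent (s ` X) (s ` Y) \<longleftrightarrow> adjacent X Y" for X Y
    by (simp only: adjacent_def image_set_diff[OF inj, symmetric]
        card_image[OF inj_on_subset[OF inj subset_UNIV]])
  moreover have "bij_betw ((`) s) {X. maximal_singular X} {X. maximal_singular X}"
    by (rule bij_betw_byWitness[where f' = "(`) (inv s)"])
      (auto simp: image_comp permutes_inv_o[OF s]
        symplectic_maximal_singular assms symplectic_inv)
  ultimately show ?thesis by (simp add: H_aleph0_automorphism_iff)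
qed

end

(* Fix a vertex X. Sending Y to X - Y identifies the vertices with the subsets of X, and two
   vertices are adjacent iff the corresponding subsets differ in exactly one element. So g becomes
   an isomorphism between the cubes of subsets of X and of g X that fixes the empty set. It
   permutes the singletons, which gives a bijection from X to g X, extended to a symplectic
   permutation by oddness. A finite F with two distinct elements a, b is the common neighbour
   of F - {a} and F - {b} other than F - {a, b}, so by induction on the cardinality the bijection
   determines the isomorphism on all finite subsets, which make up the component of X. *)

theory Submission
  imports Defs
begin

section \<open>Isomorphisms of infinite cubes\<close>

text \<open>If \<open>U\<close> arises from \<open>F - {a}\<close> by toggling \<open>c\<close> and
  from \<open>F - {b}\<close> by toggling \<open>d\<close>, then \<open>c\<close> and
  \<open>d\<close> together are \<open>a\<close> and \<open>b\<close>. Toggling \<open>a\<close> in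
  \<open>F - {a}\<close> restores \<open>F\<close>; toggling \<open>b\<close> leaves
  \<open>F - {a, b}\<close>.\<close>

lemma cube_common_neighbours:
  assumes "a \<in> F" "b \<in> F" "a \<noteq> b"
    and "card (sym_diff U (F - {a})) = 1" "card (sym_diff U (F - {b})) = 1"
  shows "U = F \<or> U = F - {a, b}"
proof -
  obtain c d where c: "sym_diff U (F - {a}) = {c}" and d: "sym_diff U (F - {b}) = {d}"
    using assms(4,5) by (auto simp: card_1_singleton_iff)
  have "sym_diff {c} {d} = sym_diff (F - {a}) (F - {b})"
    unfolding c[symmetric] d[symmetric] by blast
  also have "\<dots> = {a, b}" using assms(1-3) by blast
  finally have "c = a \<or> c = b" by blast
  moreover have "U = sym_diff (F - {a}) {c}" using c by blast
  ultimately show ?thesis using assms(1-3) by blast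
qed

text \<open>Finiteness of \<open>F\<close> matters: for infinite \<open>A\<close> no edge joins a
  finite subset to an infinite one, so \<open>k\<close> could toggle a fixed element in all infinite
  subsets without affecting the finite ones.\<close>

lemma cube_isomorphism_finite_subsets:
  fixes k :: "'a set \<Rightarrow> 'b set"
  assumes bij: "bij_betw k (Pow A) (Pow B)"
    and adj: "\<And>F G. F \<subseteq> A \<Longrightarrow> G \<subseteq> A \<Longrightarrow>
      card (sym_diff (k F) (k G)) = 1 \<longleftrightarrow> card (sym_diff F G) = 1"
    and empty: "k {} = {}"
  obtains \<sigma> where "bij_betw \<sigma> A B" "\<And>F. finite F \<Longrightarrow> F \<subseteq> A \<Longrightarrow> k F = \<sigma> ` F"
proof -
  have sub: "k F \<subseteq> B" if "F \<subseteq> A" for F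
    using bij_betwE[OF bij] that by blast
  have inj: "F = G" if "k F = k G" "F \<subseteq> A" "G \<subseteq> A" for F G
    using bij_betw_imp_inj_on[OF bij] that by (auto dest: inj_onD)
  \<comment> \<open>Singletons are exactly the neighbours of the empty set, which \<open>k\<close>
    fixes.\<close>
  have card1: "card (k F) = 1 \<longleftrightarrow> card F = 1" if "F \<subseteq> A" for F
    using adj[of F "{}"] that by (simp add: empty)
  have "\<exists>y. k {x} = {y}" if "x \<in> A" for x
    using card1[of "{x}"] that by (simp add: card_1_singleton_iff)
  then obtain \<sigma> where \<sigma>: "\<And>x. x \<in> A \<Longrightarrow> k {x} = {\<sigma> x}" by metis
  have \<sigma>_inj: "inj_on \<sigma> A"
    by (rule inj_onI) (use \<sigma> inj in \<open>metis empty_subsetI insert_subset singleton_inject\<close>)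
  have \<sigma>_surj: "\<sigma> ` A = B"
  proof (intro equalityI subsetI)
    fix y assume "y \<in> \<sigma> ` A"
    then show "y \<in> B" using \<sigma> sub by (metis empty_subsetI imageE insert_subset)
  next
    fix y assume "y \<in> B"
    then have "{y} \<in> k ` Pow A" using bij by (simp add: bij_betw_def)
    then obtain F where F: "F \<subseteq> A" "k F = {y}" by auto
    then obtain x where "F = {x}" using card1[of F] by (auto simp: card_1_singleton_iff)
    then show "y \<in> \<sigma> ` A" using F \<sigma> by auto
  qed
  have "k F = \<sigma> ` F" if "finite F" "F \<subseteq> A" for F
    using that
  proof (induction "card F" arbitrary: F rule: less_induct)
    case less
    show ?case
    proof (cases "\<exists>a\<in>F. \<exists>b\<in>F. a \<noteq> b")
      case False
      then have "F = {} \<or> (\<exists>a. F = {a})" by blast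
      then show ?thesis using \<sigma> empty less.prems by auto
    next
      case True
      then obtain a b where ab: "a \<in> F" "b \<in> F" "a \<noteq> b" by blast
      have IH: "k G = \<sigma> ` G" if "G \<subset> F" for G
        using that less.hyps[OF psubset_card_mono[OF less.prems(1)]] less.prems
        by (meson finite_subset psubset_imp_subset subset_trans)
      have img: "\<sigma> ` (F - G) = \<sigma> ` F - \<sigma> ` G" if "G \<subseteq> F" for G
        using that less.prems by (intro inj_on_image_set_diff[OF \<sigma>_inj]) auto
      \<comment> \<open>By the induction hypothesis the second set is \<open>k (F - {x})\<close>, so
        \<open>k F\<close> is a common neighbour of two known sets; injectivity of \<open>k\<close>
        then excludes the other candidate.\<close>
      have adjF: "card (sym_diff (k F) (\<sigma> ` F - {\<sigma> x})) = 1" if "x \<in> F" for x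
      proof -
        have "sym_diff F (F - {x}) = {x}" "F - {x} \<subset> F" using that by blast+
        then show ?thesis
          using adj[of F "F - {x}"] IH[of "F - {x}"] img[of "{x}"] less.prems that by auto
      qed
      have "k F \<noteq> k (F - {a, b})"
        using inj[of F "F - {a, b}"] ab less.prems by blast
      moreover have "k (F - {a, b}) = \<sigma> ` F - {\<sigma> a, \<sigma> b}"
        using IH[of "F - {a, b}"] img[of "{a, b}"] ab by auto
      moreover have "\<sigma> a \<noteq> \<sigma> b" using ab less.prems \<sigma>_inj by (metis inj_onD subsetD)
      ultimately show ?thesis
        using cube_common_neighbours[of "\<sigma> a" "\<sigma> ` F" "\<sigma> b" "k F"] adjF ab by auto
    qed
  qed
  with \<sigma>_inj \<sigma>_surj show thesis by (intro that) (simp_all add: bij_betw_def)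
qed

section \<open>Cube coordinates centred at a vertex\<close>

text \<open>The inverse of the coordinate map sending \<open>Y\<close> to \<open>X - Y\<close>: for
  a vertex \<open>X\<close> and \<open>F \<subseteq> X\<close>, the vertex with coordinate
  \<open>F\<close>.\<close>

definition flip :: "int set \<Rightarrow> int set \<Rightarrow> int set" where
  "flip X F = (X - F) \<union> uminus ` F"

lemma mem_uminus_image: "(i::int) \<in> uminus ` F \<longleftrightarrow> - i \<in> F"
  by force

lemma flip_empty [simp]: "flip X {} = X"
  by (simp add: flip_def)

lemma maximal_singularD:
  assumes "maximal_singular X"
  shows "0 \<notin> X" "i \<noteq> 0 \<Longrightarrow> - i \<in> X \<longleftrightarrow> i \<notin> X" "i \<in> X \<Longrightarrow> - i \<notin> X"
  using assms unfolding maximal_singular_iff by metis+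

lemma mem_flip:
  assumes "maximal_singular X" "F \<subseteq> X" "i \<in> X"
  shows "i \<in> flip X F \<longleftrightarrow> i \<notin> F" "- i \<in> flip X F \<longleftrightarrow> i \<in> F"
  using assms maximal_singularD(3)[OF assms(1)] by (auto simp: flip_def mem_uminus_image)

lemma maximal_singular_flip:
  assumes "maximal_singular X" "F \<subseteq> X"
  shows "maximal_singular (flip X F)"
  unfolding maximal_singular_iff
proof (intro conjI allI impI)
  show "0 \<notin> flip X F"
    using assms maximal_singularD(1)[OF assms(1)] by (auto simp: flip_def)
  fix i :: int assume "i \<noteq> 0"
  then have "i \<in> X \<or> - i \<in> X" using maximal_singularD(2)[OF assms(1)] by blast
  then show "(i \<in> flip X F) \<noteq> (- i \<in> flip X F)"
    using mem_flip[OF assms, of i] mem_flip[OF assms, of "- i"] by auto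
qed

lemma Diff_flip:
  assumes "maximal_singular X" "F \<subseteq> X"
  shows "X - flip X F = F"
  using mem_flip[OF assms] assms(2) by blast

lemma flip_Diff:
  assumes "maximal_singular X" "maximal_singular Y"
  shows "flip X (X - Y) = Y"
proof (rule set_eqI)
  fix i
  show "i \<in> flip X (X - Y) \<longleftrightarrow> i \<in> Y"
    using maximal_singularD(1)[OF assms(1)] maximal_singularD(1)[OF assms(2)]
      maximal_singularD(2)[OF assms(1), of i] maximal_singularD(2)[OF assms(2), of i]
    by (cases "i = 0") (auto simp: flip_def mem_uminus_image)
qed

lemma bij_betw_Diff:
  assumes "maximal_singular X"
  shows "bij_betw (\<lambda>Y. X - Y) {Y. maximal_singular Y} (Pow X)"
  by (rule bij_betw_byWitness[where f' = "flip X"])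
    (auto simp: Diff_flip flip_Diff maximal_singular_flip assms)

lemma bij_betw_flip:
  assumes "maximal_singular X"
  shows "bij_betw (flip X) (Pow X) {Y. maximal_singular Y}"
  by (rule bij_betw_byWitness[where f' = "\<lambda>Y. X - Y"])
    (auto simp: Diff_flip flip_Diff maximal_singular_flip assms)

lemma card_flip_diff:
  assumes "maximal_singular X" "F \<subseteq> X" "G \<subseteq> X"
  shows "card (flip X F - flip X G) = card (sym_diff F G)"
proof -
  \<comment> \<open>For \<open>i\<close> in exactly one of \<open>F\<close> and \<open>G\<close>,
    this picks the sign of \<open>i\<close> that lies in \<open>flip X F\<close> and not in
    \<open>flip X G\<close>.\<close>
  define r where "r i = (if i \<in> G then i else - i)" for i
  have "inj_on r (sym_diff F G)"
    using assms maximal_singularD(3)[OF assms(1)] unfolding r_def inj_on_def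
    by (metis DiffE UnE minus_minus subset_iff)
  moreover have "r ` sym_diff F G = flip X F - flip X G"
  proof -
    have "r ` sym_diff F G = (G - F) \<union> uminus ` (F - G)"
      by (auto simp: r_def image_iff mem_uminus_image)
    also have "\<dots> = flip X F - flip X G"
      using assms(2,3) maximal_singularD(3)[OF assms(1)]
      unfolding set_eq_iff flip_def Un_iff Diff_iff mem_uminus_image by blast
    finally show ?thesis .
  qed
  ultimately show ?thesis by (metis card_image)
qed

text \<open>Both differences in \<open>adjacent\<close> have the cardinality of the symmetric
  difference of the coordinates, so the two conditions merge into one.\<close>

lemma adjacent_iff_card_sym_diff:
  assumes "maximal_singular X" "maximal_singular Y" "maximal_singular Z"
  shows "adjacent Y Z \<longleftrightarrow> card (sym_diff (X - Y) (X - Z)) = 1"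
  using card_flip_diff[OF assms(1), of "X - Y" "X - Z"]
    card_flip_diff[OF assms(1), of "X - Z" "X - Y"] assms
  by (simp add: adjacent_def flip_Diff Un_commute)

text \<open>Each edge adds at most one element to the coordinate, so a component stays among the
  finite subsets, where the cube isomorphism is known.\<close>

lemma reachable_finite_Diff:
  assumes "X \<rightarrow>\<^sup>*\<^bsub>H_aleph0\<^esub> Y"
  shows "maximal_singular X \<and> maximal_singular Y \<and> finite (X - Y)"
  using assms
proof (induction rule: H_aleph0.reachable_induct)
  case base
  then show ?case by (simp add: H_aleph0_def)
next
  case (step Y Z)
  then have "maximal_singular Z" "adjacent Y Z"
    by (auto simp: H_aleph0_def arcs_ends_def arc_to_ends_def)
  moreover from this have "finite (Y - Z)"
    by (auto simp: adjacent_def intro: card_ge_0_finite)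
  ultimately show ?case
    using step.IH by (auto intro: finite_subset[of "X - Z" "(X - Y) \<union> (Y - Z)"])
qed

section \<open>Extending a bijection of vertices to a symplectic permutation\<close>

lemma symplectic_extension:
  assumes X: "maximal_singular X" and Z: "maximal_singular Z" and \<sigma>: "bij_betw \<sigma> X Z"
  obtains s where "symplectic s" "\<And>F. F \<subseteq> X \<Longrightarrow> s ` flip X F = flip Z (\<sigma> ` F)"
proof -
  \<comment> \<open>One of \<open>i\<close> and \<open>- i\<close> lies in \<open>X\<close> unless
    \<open>i = 0\<close>, so the last branch only fixes \<open>0\<close>, as \<open>permutes\<close>
    demands.\<close>
  define s where "s i = (if i \<in> X then \<sigma> i else if - i \<in> X then - \<sigma> (- i) else 0)" for i
  have s_X: "s i = \<sigma> i" if "i \<in> X" for i using that by (simp add: s_def)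
  have s_neg: "s (- i) = - \<sigma> i" if "i \<in> X" for i
    using that maximal_singularD(3)[OF X] by (simp add: s_def)
  have s_0: "s 0 = 0" using maximal_singularD(1)[OF X] by (simp add: s_def)
  have \<sigma>Z: "\<sigma> i \<in> Z" if "i \<in> X" for i using bij_betwE[OF \<sigma>] that by blast
  have s_odd: "s (- i) = - s i" if "i \<noteq> 0" for i
    using maximal_singularD(2)[OF X that] by (auto simp: s_def)
  have s_mem: "s i \<in> Z \<longleftrightarrow> i \<in> X" for i
    using maximal_singularD(1)[OF Z] maximal_singularD(3)[OF Z] \<sigma>Z by (auto simp: s_def)
  have s_nz: "s i \<noteq> 0" if "i \<noteq> 0" for i
    using maximal_singularD(1)[OF Z] maximal_singularD(2)[OF X that] \<sigma>Z[of i] \<sigma>Z[of "- i"]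
    by (auto simp: s_def)
  have s_inj: "i = j" if eq: "s i = s j" for i j
  proof -
    \<comment> \<open>Here \<open>s_mem\<close> forces \<open>j\<close> into \<open>X\<close> as
      well, where \<open>s\<close> is the injective \<open>\<sigma>\<close>; oddness reduces the
      negative case to this one.\<close>
    have inj: "i = j" if "s i = s j" "i \<in> X" for i j
      using that s_mem[of i] s_mem[of j] bij_betw_imp_inj_on[OF \<sigma>]
      by (auto simp: s_X dest: inj_onD)
    consider "i = 0" | "i \<in> X" | "i \<noteq> 0" "- i \<in> X"
      using maximal_singularD(2)[OF X, of i] by blast
    then show ?thesis
    proof cases
      case 1
      then show ?thesis using eq s_0 s_nz by metis
    next
      case 2
      then show ?thesis using eq inj by blast
    next
      case 3
      then have "j \<noteq> 0" using eq s_0 s_nz by metis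
      then have "s (- i) = s (- j)" using eq s_odd 3 by simp
      then show ?thesis using inj[of "- i" "- j"] 3 by simp
    qed
  qed
  have s_surj: "\<exists>i. s i = j" for j
  proof -
    have surj: "\<exists>i\<in>X. \<sigma> i = j" if "j \<in> Z" for j
      using \<sigma> that by (auto simp: bij_betw_def)
    consider "j = 0" | "j \<in> Z" | "- j \<in> Z"
      using maximal_singularD(2)[OF Z, of j] by blast
    then show ?thesis
    proof cases
      case 1
      then show ?thesis using s_0 by blast
    next
      case 2
      then show ?thesis using surj s_X by metis
    next
      case 3
      then show ?thesis using surj s_neg by (metis minus_minus)
    qed
  qed
  have "s permutes - {0}"
    unfolding permutes_def using s_0 s_inj s_surj by auto
  then have "symplectic s" using s_odd by (simp add: symplectic_def)
  moreover have "s ` flip X F = flip Z (\<sigma> ` F)" if F: "F \<subseteq> X" for F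
  proof -
    have "s ` (X - F) = \<sigma> ` (X - F)" using s_X by auto
    also have "\<dots> = Z - \<sigma> ` F"
      using F \<sigma> by (simp add: bij_betw_def inj_on_image_set_diff[of \<sigma> X X F])
    finally have "s ` (X - F) = Z - \<sigma> ` F" .
    moreover have "s ` uminus ` F = uminus ` \<sigma> ` F"
      unfolding image_image by (rule image_cong) (use F s_neg in auto)
    ultimately show ?thesis by (simp add: flip_def image_Un)
  qed
  ultimately show thesis by (rule that)
qed

theorem theorem1:
  fixes g :: "int set \<Rightarrow> int set" and C :: "int set set"
  assumes "graph_automorphism H_aleph0 g"
    and "C \<in> pre_digraph.sccs_verts H_aleph0"
  shows "\<exists>s. symplectic s \<and> (\<forall>Y\<in>C. g Y = s ` Y)"
proof -
  have g: "bij_betw g {X. maximal_singular X} {X. maximal_singular X}"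
    and g_adj: "\<And>X Y. maximal_singular X \<Longrightarrow> maximal_singular Y \<Longrightarrow>
      adjacent (g X) (g Y) \<longleftrightarrow> adjacent X Y"
    using assms(1) by (auto simp: H_aleph0_automorphism_iff)
  have g_max: "maximal_singular (g Y)" if "maximal_singular Y" for Y
    using bij_betwE[OF g] that by blast
  obtain X where X: "maximal_singular X" and C: "C = {Y. X \<rightarrow>\<^sup>*\<^bsub>H_aleph0\<^esub> Y}"
    using assms(2) by (auto simp: H_aleph0_component_iff)
  \<comment> \<open>This is \<open>g\<close> read in cube coordinates centred at \<open>X\<close> in
    the source and at \<open>g X\<close> in the target; the choice of centres makes it fix the empty
    set.\<close>
  define k where "k F = g X - g (flip X F)" for F
  have "k = (\<lambda>Y. g X - Y) \<circ> (g \<circ> flip X)" by (auto simp: k_def)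
  then have bij: "bij_betw k (Pow X) (Pow (g X))"
    using bij_betw_trans[OF bij_betw_trans[OF bij_betw_flip[OF X] g]
        bij_betw_Diff[OF g_max[OF X]]] by simp
  have adj: "card (sym_diff (k F) (k G)) = 1 \<longleftrightarrow> card (sym_diff F G) = 1"
    if FG: "F \<subseteq> X" "G \<subseteq> X" for F G
  proof -
    note max = maximal_singular_flip[OF X FG(1)] maximal_singular_flip[OF X FG(2)]
    show ?thesis
      using adjacent_iff_card_sym_diff[OF g_max[OF X] g_max[OF max(1)] g_max[OF max(2)]]
        adjacent_iff_card_sym_diff[OF X max] g_adj[OF max]
      by (simp add: k_def Diff_flip[OF X FG(1)] Diff_flip[OF X FG(2)])
  qed
  have "k {} = {}" by (simp add: k_def)
  then obtain \<sigma> where \<sigma>: "bij_betw \<sigma> X (g X)"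
    and k: "\<And>F. finite F \<Longrightarrow> F \<subseteq> X \<Longrightarrow> k F = \<sigma> ` F"
    using cube_isomorphism_finite_subsets[OF bij adj] by blast
  obtain s where s: "symplectic s"
    and s_flip: "\<And>F. F \<subseteq> X \<Longrightarrow> s ` flip X F = flip (g X) (\<sigma> ` F)"
    using symplectic_extension[OF X g_max[OF X] \<sigma>] by blast
  have "g Y = s ` Y" if "Y \<in> C" for Y
  proof -
    have Y: "maximal_singular Y" "finite (X - Y)"
      using reachable_finite_Diff that by (auto simp: C)
    \<comment> \<open>The vertex \<open>g Y\<close> is recovered from its coordinate at
      \<open>g X\<close>, which is \<open>k (X - Y)\<close>.\<close>
    have "g Y = flip (g X) (g X - g Y)"
      using flip_Diff[OF g_max[OF X] g_max[OF Y(1)]] by simp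
    also have "g X - g Y = \<sigma> ` (X - Y)"
      using k[of "X - Y"] Y by (simp add: k_def flip_Diff[OF X])
    also have "flip (g X) (\<sigma> ` (X - Y)) = s ` Y"
      using s_flip[of "X - Y"] by (simp add: flip_Diff[OF X Y(1)])
    finally show ?thesis .
  qed
  with s show ?thesis by blast
qed

end
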